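(* Let $A\in\mathbb{R}^{n\times n}$ be symmetric positive semidefinite (possibly, but not necessarily, positive definite), let $R$ be a real matrix with $n$ columns such that $R^\top R\succ0$, and for $\alpha\in(0,1)$ put $A_\alpha=(1-\alpha)A+\alpha R^\top R$. Then Weyl's inequality gives $$\kappa(A_\alpha)\;\le\;\frac{(1-\alpha)\lambda_{\max}(A)+\alpha\,\lambda_{\max}(R^\top R)}{\alpha\,\lambda_{\min}(R^\top R)}.$$ This bound decreases monotonically in $\alpha$; for the scaled-identity target $R^\top R=\bar\lambda I$ it is $$\kappa(A_\alpha)\;\le\;\frac{1-\alpha}{\alpha}\,\frac{\lambda_{\max}(A)}{\bar\lambda}+1\;=\;O\big((1-\alpha)/\alpha\big).$$
   Context: $\lambda_{\min},\lambda_{\max}$ denote the smallest and largest eigenvalues of a symmetric matrix, and $\kappa(\cdot)=\lambda_{\max}(\cdot)/\lambda_{\min}(\cdot)$ is the spectral condition number of a symmetric positive definite matrix. The scalar $\bar\lambda$ is positive, since $R^\top R\succ0$. *)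

theory Defs
  imports "HOL-Analysis.Analysis" "HOL-Library.Landau_Symbols"
begin

definition symmetric_matrix :: "real^'n^'n \<Rightarrow> bool" where
  "symmetric_matrix A \<longleftrightarrow> transpose A = A"

definition pos_semidef :: "real^'n^'n \<Rightarrow> bool" where
  "pos_semidef A \<longleftrightarrow> symmetric_matrix A \<and> (\<forall>x. x \<bullet> (A *v x) \<ge> 0)"

definition pos_def :: "real^'n^'n \<Rightarrow> bool" where
  "pos_def A \<longleftrightarrow> symmetric_matrix A \<and> (\<forall>x. x \<noteq> 0 \<longrightarrow> x \<bullet> (A *v x) > 0)"

definition eigenvalue :: "real^'n^'n \<Rightarrow> real \<Rightarrow> bool" where
  "eigenvalue A k \<longleftrightarrow> (\<exists>v. v \<noteq> 0 \<and> A *v v = k *\<^sub>R v)"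

text \<open>These three are used for symmetric matrices only (the last one for positive definite
  matrices only); for a matrix without real eigenvalues they are unspecified.\<close>

definition lambda_min :: "real^'n^'n \<Rightarrow> real" where
  "lambda_min A = (LEAST k. eigenvalue A k)"

definition lambda_max :: "real^'n^'n \<Rightarrow> real" where
  "lambda_max A = (GREATEST k. eigenvalue A k)"

definition cond_number :: "real^'n^'n \<Rightarrow> real" where
  "cond_number A = lambda_max A / lambda_min A"

definition blend :: "real^'n^'n \<Rightarrow> real^'n^'m \<Rightarrow> real \<Rightarrow> real^'n^'n" where
  "blend A R \<alpha> = (1 - \<alpha>) *\<^sub>R A + \<alpha> *\<^sub>R (transpose R ** R)"

definition cond_bound :: "real^'n^'n \<Rightarrow> real^'n^'m \<Rightarrow> real \<Rightarrow> real" where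
  "cond_bound A R \<alpha> =
    ((1 - \<alpha>) * lambda_max A + \<alpha> * lambda_max (transpose R ** R))
      / (\<alpha> * lambda_min (transpose R ** R))"

end

theory Submission
  imports Defs
begin

text \<open>Everything rests on the variational description of the extreme eigenvalues: for a symmetric
  \<open>A\<close>, \<open>lambda_min A\<close> and \<open>lambda_max A\<close> exist and are the best constants \<open>m\<close>, \<open>M\<close> in
  \<open>m * (x \<bullet> x) \<le> x \<bullet> (A *v x) \<le> M * (x \<bullet> x)\<close> (lemmas \<open>lambda_min_rayleigh\<close> and
  \<open>lambda_max_rayleigh\<close>). They come from compactness of the unit sphere: at a minimiser \<open>v\<close> of the
  quadratic form, with minimum \<open>m\<close>, the form of \<open>A - m I\<close> is nonnegative and vanishes at \<open>v\<close>,
  and a nonnegative form can vanish only on the kernel of its matrix, so \<open>A *v v = m *\<^sub>R v\<close>.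

  Weyl's inequality for a blend is then immediate, because quadratic forms add:
  \<open>lambda_max\<close> of the blend is at most the blend of the \<open>lambda_max\<close> values, and \<open>lambda_min\<close> of
  the blend is at least \<open>\<alpha> * lambda_min (transpose R ** R)\<close>, the term from \<open>A\<close> being nonnegative.
  Dividing gives the bound on the condition number.

  Dividing numerator and denominator of the bound by \<open>\<alpha>\<close> shows that it is an affine function of
  \<open>(1 - \<alpha>) / \<alpha>\<close>, which is strictly decreasing, with slope
  \<open>lambda_max A / lambda_min (transpose R ** R)\<close>. The slope is nonnegative, and it is positive when
  \<open>A \<noteq> 0\<close>, since a positive semidefinite matrix with \<open>lambda_max A = 0\<close> has zero quadratic form and
  hence annihilates every vector.
  For \<open>transpose R ** R = lbar I\<close> both extreme eigenvalues equal \<open>lbar\<close>, which gives the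
  closed form; the asymptotic claims follow since \<open>(1 - \<alpha>) / \<alpha> \<ge> 1\<close> for small \<open>\<alpha>\<close>.\<close>

section \<open>Extreme eigenvalues of a symmetric matrix\<close>

lemma symmetric_matrix_inner:
  fixes A :: "real^'n^'n"
  assumes "symmetric_matrix A"
  shows "x \<bullet> (A *v y) = y \<bullet> (A *v x)"
  using assms dot_lmul_matrix[of y A x] vector_transpose_matrix[of y A]
  by (simp add: symmetric_matrix_def inner_commute)

lemma symmetric_matrix_uminus:
  fixes A :: "real^'n^'n"
  shows "symmetric_matrix A \<Longrightarrow> symmetric_matrix (- A)"
  by (simp add: symmetric_matrix_def transpose_def vec_eq_iff)

lemma uminus_matrix_vector_mult:
  fixes A :: "real^'n^'n"
  shows "(- A) *v x = - (A *v x)"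
  by (simp add: matrix_vector_mult_def vec_eq_iff sum_negf)

text \<open>Otherwise moving from \<open>v\<close> a short way in the direction \<open>- (B *v v)\<close> would make the form
  negative: its first-order change along \<open>w = B *v v\<close> is \<open>-2 s (w \<bullet> w)\<close>.\<close>

lemma nonneg_form_zero_imp_kernel:
  fixes B :: "real^'n^'n"
  assumes sym: "symmetric_matrix B" and nonneg: "\<And>x. 0 \<le> x \<bullet> (B *v x)" and zero: "v \<bullet> (B *v v) = 0"
  shows "B *v v = 0"
proof (rule ccontr)
  define w where "w = B *v v"
  define a where "a = w \<bullet> w"
  define b where "b = w \<bullet> (B *v w)"
  assume "B *v v \<noteq> 0"
  then have a: "a > 0" by (simp add: a_def w_def)
  have b: "b \<ge> 0" using nonneg by (simp add: b_def)
  have expand: "(v - s *\<^sub>R w) \<bullet> (B *v (v - s *\<^sub>R w)) = - 2 * s * a + s\<^sup>2 * b" for s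
    using symmetric_matrix_inner[OF sym, of v w] zero
    by (simp add: matrix_vector_mult_diff_distrib matrix_vector_mult_scaleR inner_diff_left
        inner_diff_right w_def[symmetric] a_def b_def power2_eq_square algebra_simps)
  \<comment> \<open>The exact minimiser of the parabola would be \<open>a / b\<close>; the shift by 1 covers \<open>b = 0\<close>.\<close>
  define s where "s = a / (b + 1)"
  have s: "s > 0" using a b by (simp add: s_def)
  have "s * b \<le> a" using a b by (simp add: s_def field_simps)
  then have "s * (s * b) \<le> s * a" using s by (intro mult_left_mono) auto
  moreover have "0 < s * a" using s a by simp
  moreover have "0 \<le> - 2 * s * a + s * (s * b)"
    using nonneg[of "v - s *\<^sub>R w"] expand[of s] by (simp add: power2_eq_square algebra_simps)
  ultimately show False by linarith
qed

lemma symmetric_form_minimum_eigenvector: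
  fixes A :: "real^'n^'n"
  assumes sym: "symmetric_matrix A"
  obtains m where "eigenvalue A m" "\<And>x. m * (x \<bullet> x) \<le> x \<bullet> (A *v x)"
proof -
  have "continuous_on (sphere 0 1) (\<lambda>x::real^'n. x \<bullet> (A *v x))"
    by (intro continuous_intros linear_continuous_on matrix_vector_mul_bounded_linear)
  moreover have "sphere (0::real^'n) 1 \<noteq> {}" by simp
  ultimately obtain v :: "real^'n" where v: "norm v = 1"
    and min: "\<And>y. norm y = 1 \<Longrightarrow> v \<bullet> (A *v v) \<le> y \<bullet> (A *v y)"
    using continuous_attains_inf[OF compact_sphere, of "0::real^'n" 1] by force
  define m where "m = v \<bullet> (A *v v)"
  have bound: "m * (x \<bullet> x) \<le> x \<bullet> (A *v x)" for x
  proof (cases "x = 0")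
    case False
    define u where "u = x /\<^sub>R norm x"
    have x: "x = norm x *\<^sub>R u" and u: "norm u = 1" using False by (simp_all add: u_def)
    have "x \<bullet> (A *v x) = (norm x)\<^sup>2 * (u \<bullet> (A *v u))"
      by (subst (1 2) x) (simp add: matrix_vector_mult_scaleR power2_eq_square)
    then show ?thesis
      using min[OF u] by (simp add: m_def power2_norm_eq_inner[symmetric] mult.commute mult_right_mono)
  qed simp
  define B where "B = A - m *\<^sub>R mat 1"
  have Bv: "B *v x = A *v x - m *\<^sub>R x" for x
    by (simp add: B_def matrix_vector_mult_diff_rdistrib scaleR_matrix_vector_assoc[symmetric])
  have "symmetric_matrix B"
    using sym by (auto simp: B_def symmetric_matrix_def transpose_def vec_eq_iff mat_def)
  then have "B *v v = 0"
  proof (rule nonneg_form_zero_imp_kernel)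
    show "0 \<le> x \<bullet> (B *v x)" for x using bound[of x] by (simp add: Bv inner_diff_right)
    show "v \<bullet> (B *v v) = 0"
      using v by (simp add: Bv inner_diff_right m_def power2_norm_eq_inner[symmetric])
  qed
  then have "eigenvalue A m" using v by (auto simp: eigenvalue_def Bv intro!: exI[of _ v])
  then show thesis using bound that by blast
qed

lemma eigenvalue_ge_form_bound:
  fixes A :: "real^'n^'n"
  assumes "eigenvalue A k" "\<And>x. c * (x \<bullet> x) \<le> x \<bullet> (A *v x)"
  shows "c \<le> k"
proof -
  obtain v where v: "v \<noteq> 0" "A *v v = k *\<^sub>R v" using assms(1) by (auto simp: eigenvalue_def)
  then have "c * (v \<bullet> v) \<le> k * (v \<bullet> v)" using assms(2)[of v] by simp
  then show ?thesis using v(1) by simp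
qed

lemma eigenvalue_uminus:
  fixes A :: "real^'n^'n"
  shows "eigenvalue (- A) k \<longleftrightarrow> eigenvalue A (- k)"
proof -
  have "- y = k *\<^sub>R v \<longleftrightarrow> y = - k *\<^sub>R v" for y v :: "real^'n"
    by (metis minus_equation_iff scaleR_minus_left)
  then show ?thesis by (simp add: eigenvalue_def uminus_matrix_vector_mult)
qed

lemma eigenvalue_le_form_bound:
  fixes A :: "real^'n^'n"
  assumes "eigenvalue A k" "\<And>x. x \<bullet> (A *v x) \<le> c * (x \<bullet> x)"
  shows "k \<le> c"
  using eigenvalue_ge_form_bound[of "- A" "- k" "- c"] assms
  by (simp add: eigenvalue_uminus uminus_matrix_vector_mult)

lemma lambda_min_rayleigh:
  fixes A :: "real^'n^'n"
  assumes "symmetric_matrix A"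
  shows "eigenvalue A (lambda_min A)" "lambda_min A * (x \<bullet> x) \<le> x \<bullet> (A *v x)"
proof -
  obtain m where m: "eigenvalue A m" "\<And>x. m * (x \<bullet> x) \<le> x \<bullet> (A *v x)"
    using symmetric_form_minimum_eigenvector[OF assms] by blast
  then have "lambda_min A = m"
    unfolding lambda_min_def by (blast intro: Least_equality eigenvalue_ge_form_bound)
  then show "eigenvalue A (lambda_min A)" "lambda_min A * (x \<bullet> x) \<le> x \<bullet> (A *v x)"
    using m by auto
qed

lemma lambda_max_rayleigh:
  fixes A :: "real^'n^'n"
  assumes "symmetric_matrix A"
  shows "eigenvalue A (lambda_max A)" "x \<bullet> (A *v x) \<le> lambda_max A * (x \<bullet> x)"
proof -
  obtain m where m: "eigenvalue (- A) m" "\<And>x. m * (x \<bullet> x) \<le> x \<bullet> ((- A) *v x)"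
    using symmetric_form_minimum_eigenvector[OF symmetric_matrix_uminus[OF assms]] by blast
  have ev: "eigenvalue A (- m)" using m(1) by (simp add: eigenvalue_uminus)
  have bd: "x \<bullet> (A *v x) \<le> - m * (x \<bullet> x)" for x
    using m(2)[of x] by (simp add: uminus_matrix_vector_mult)
  have "lambda_max A = - m"
    unfolding lambda_max_def using ev bd
    by (blast intro: Greatest_equality eigenvalue_le_form_bound)
  then show "eigenvalue A (lambda_max A)" "x \<bullet> (A *v x) \<le> lambda_max A * (x \<bullet> x)"
    using ev bd by auto
qed

lemma lambda_min_le_lambda_max:
  fixes A :: "real^'n^'n"
  assumes "symmetric_matrix A"
  shows "lambda_min A \<le> lambda_max A"
  using assms eigenvalue_ge_form_bound lambda_max_rayleigh(1) lambda_min_rayleigh(2) by blast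

lemma pos_def_lambda_min_pos:
  fixes A :: "real^'n^'n"
  assumes "pos_def A"
  shows "lambda_min A > 0"
proof -
  have "eigenvalue A (lambda_min A)"
    using assms by (simp add: pos_def_def lambda_min_rayleigh(1))
  then obtain v where v: "v \<noteq> 0" "A *v v = lambda_min A *\<^sub>R v"
    by (auto simp: eigenvalue_def)
  then have "0 < lambda_min A * (v \<bullet> v)" using assms by (auto simp: pos_def_def)
  then show ?thesis using v(1) zero_less_mult_pos2 inner_gt_zero_iff by blast
qed

lemma pos_semidef_lambda_max_nonneg:
  fixes A :: "real^'n^'n"
  assumes "pos_semidef A"
  shows "lambda_max A \<ge> 0"
  using eigenvalue_ge_form_bound[OF lambda_max_rayleigh(1), of A 0] assms
  by (simp add: pos_semidef_def)

lemma pos_semidef_lambda_max_pos: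
  fixes A :: "real^'n^'n"
  assumes "pos_semidef A" "A \<noteq> 0"
  shows "lambda_max A > 0"
proof (rule ccontr)
  assume "\<not> lambda_max A > 0"
  then have max: "lambda_max A = 0" using pos_semidef_lambda_max_nonneg[OF assms(1)] by simp
  have sym: "symmetric_matrix A" and nonneg: "0 \<le> x \<bullet> (A *v x)" for x
    using assms(1) by (auto simp: pos_semidef_def)
  have "A *v x = 0" for x
    using lambda_max_rayleigh(2)[OF sym, of x] nonneg[of x] max
    by (intro nonneg_form_zero_imp_kernel[OF sym nonneg]) simp
  then show False using assms(2) by (simp add: matrix_eq)
qed

lemma eigenvalue_scaled_identity:
  "eigenvalue (c *\<^sub>R mat 1 :: real^'n^'n) k \<longleftrightarrow> k = c"
proof -
  have "\<exists>v::real^'n. v \<noteq> 0" by (rule exI[of _ 1]) simp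
  then show ?thesis by (auto simp: eigenvalue_def scaleR_matrix_vector_assoc[symmetric])
qed

section \<open>The condition number of a blend\<close>

lemma blend_form:
  "x \<bullet> (blend A R \<alpha> *v x) = (1 - \<alpha>) * (x \<bullet> (A *v x)) + \<alpha> * (x \<bullet> ((transpose R ** R) *v x))"
  by (simp add: blend_def matrix_vector_mult_add_rdistrib scaleR_matrix_vector_assoc[symmetric]
      inner_add_right)

lemma symmetric_matrix_blend:
  assumes "symmetric_matrix A" "symmetric_matrix (transpose R ** R)"
  shows "symmetric_matrix (blend A R \<alpha>)"
  using assms by (simp add: symmetric_matrix_def blend_def transpose_def vec_eq_iff)

lemma pos_def_blend:
  assumes A: "pos_semidef A" and R: "pos_def (transpose R ** R)" and \<alpha>: "0 < \<alpha>" "\<alpha> < 1"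
  shows "pos_def (blend A R \<alpha>)"
  unfolding pos_def_def
proof (intro conjI allI impI)
  show "symmetric_matrix (blend A R \<alpha>)"
    using A R by (simp add: symmetric_matrix_blend pos_semidef_def pos_def_def)
  show "0 < x \<bullet> (blend A R \<alpha> *v x)" if "x \<noteq> 0" for x
    unfolding blend_form using A R \<alpha> that
    by (intro add_nonneg_pos mult_nonneg_nonneg mult_pos_pos) (auto simp: pos_semidef_def pos_def_def)
qed

text \<open>The next two lemmas are Weyl's inequality at the two ends of the spectrum. The constants that
  bound the forms of the two summands combine linearly to bound the form of the blend, and every
  eigenvalue is a value of the form on a unit vector.\<close>

lemma lambda_max_blend_le:
  fixes A :: "real^'n^'n" and R :: "real^'n^'m"
  assumes A: "symmetric_matrix A" and R: "symmetric_matrix (transpose R ** R)" and \<alpha>: "0 \<le> \<alpha>" "\<alpha> \<le> 1"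
  shows "lambda_max (blend A R \<alpha>) \<le> (1 - \<alpha>) * lambda_max A + \<alpha> * lambda_max (transpose R ** R)"
proof (rule eigenvalue_le_form_bound)
  show "eigenvalue (blend A R \<alpha>) (lambda_max (blend A R \<alpha>))"
    by (intro lambda_max_rayleigh symmetric_matrix_blend A R)
  fix x :: "real^'n"
  have "x \<bullet> (blend A R \<alpha> *v x)
      \<le> (1 - \<alpha>) * (lambda_max A * (x \<bullet> x)) + \<alpha> * (lambda_max (transpose R ** R) * (x \<bullet> x))"
    unfolding blend_form using \<alpha> by (intro add_mono mult_left_mono lambda_max_rayleigh A R) auto
  then show "x \<bullet> (blend A R \<alpha> *v x)
      \<le> ((1 - \<alpha>) * lambda_max A + \<alpha> * lambda_max (transpose R ** R)) * (x \<bullet> x)"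
    by (simp add: algebra_simps)
qed

lemma lambda_min_blend_ge:
  fixes A :: "real^'n^'n" and R :: "real^'n^'m"
  assumes A: "symmetric_matrix A" and R: "symmetric_matrix (transpose R ** R)" and \<alpha>: "0 \<le> \<alpha>" "\<alpha> \<le> 1"
  shows "(1 - \<alpha>) * lambda_min A + \<alpha> * lambda_min (transpose R ** R) \<le> lambda_min (blend A R \<alpha>)"
proof (rule eigenvalue_ge_form_bound)
  show "eigenvalue (blend A R \<alpha>) (lambda_min (blend A R \<alpha>))"
    by (intro lambda_min_rayleigh symmetric_matrix_blend A R)
  fix x :: "real^'n"
  have "(1 - \<alpha>) * (lambda_min A * (x \<bullet> x)) + \<alpha> * (lambda_min (transpose R ** R) * (x \<bullet> x))
      \<le> x \<bullet> (blend A R \<alpha> *v x)"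
    unfolding blend_form using \<alpha> by (intro add_mono mult_left_mono lambda_min_rayleigh A R) auto
  then show "((1 - \<alpha>) * lambda_min A + \<alpha> * lambda_min (transpose R ** R)) * (x \<bullet> x)
      \<le> x \<bullet> (blend A R \<alpha> *v x)"
    by (simp add: algebra_simps)
qed

lemma pos_semidef_lambda_min_nonneg:
  fixes A :: "real^'n^'n"
  assumes "pos_semidef A"
  shows "lambda_min A \<ge> 0"
  using eigenvalue_ge_form_bound[OF lambda_min_rayleigh(1), of A 0] assms
  by (simp add: pos_semidef_def)

lemma cond_number_blend_le:
  assumes A: "pos_semidef A" and R: "pos_def (transpose R ** R)" and \<alpha>: "0 < \<alpha>" "\<alpha> < 1"
  shows "cond_number (blend A R \<alpha>) \<le> cond_bound A R \<alpha>"
  unfolding cond_number_def cond_bound_def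
proof (rule frac_le)
  have sym: "symmetric_matrix A" "symmetric_matrix (transpose R ** R)"
    using A R by (auto simp: pos_semidef_def pos_def_def)
  have pos: "0 < lambda_min (transpose R ** R)" using R by (rule pos_def_lambda_min_pos)
  show "lambda_max (blend A R \<alpha>) \<le> (1 - \<alpha>) * lambda_max A + \<alpha> * lambda_max (transpose R ** R)"
    using lambda_max_blend_le[OF sym] \<alpha> by simp
  have "0 \<le> (1 - \<alpha>) * lambda_min A"
    using pos_semidef_lambda_min_nonneg[OF A] \<alpha> by simp
  then show "\<alpha> * lambda_min (transpose R ** R) \<le> lambda_min (blend A R \<alpha>)"
    using lambda_min_blend_ge[OF sym, of \<alpha>] \<alpha> by simp
  show "0 < \<alpha> * lambda_min (transpose R ** R)" using pos \<alpha> by simp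
  have "0 \<le> lambda_max (transpose R ** R)"
    using pos lambda_min_le_lambda_max[OF sym(2)] by simp
  then show "0 \<le> (1 - \<alpha>) * lambda_max A + \<alpha> * lambda_max (transpose R ** R)"
    using pos_semidef_lambda_max_nonneg[OF A] \<alpha> by simp
qed

lemma cond_number_nonneg:
  fixes A :: "real^'n^'n"
  assumes "pos_def A"
  shows "cond_number A \<ge> 0"
proof -
  have "symmetric_matrix A" using assms by (simp add: pos_def_def)
  then show ?thesis
    using pos_def_lambda_min_pos[OF assms] lambda_min_le_lambda_max[of A]
    by (simp add: cond_number_def)
qed

section \<open>Monotonicity and growth of the bound\<close>

text \<open>This form isolates the dependence on \<open>\<alpha>\<close> in the single ratio \<open>(1 - \<alpha>) / \<alpha>\<close>, from which
  monotonicity, the scaled-identity case and the growth rate are all read off.\<close>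

lemma cond_bound_affine_in_ratio:
  assumes "\<alpha> > 0"
  shows "cond_bound A R \<alpha> = (1 - \<alpha>) / \<alpha> * (lambda_max A / lambda_min (transpose R ** R))
    + lambda_max (transpose R ** R) / lambda_min (transpose R ** R)"
  using assms by (simp add: cond_bound_def add_divide_distrib)

lemma ratio_strict_decreasing:
  fixes a b :: real
  assumes "0 < a" "a < b"
  shows "(1 - b) / b < (1 - a) / a"
  using assms by (simp add: field_simps)

lemma antimono_cond_bound:
  assumes A: "pos_semidef A" and R: "pos_def (transpose R ** R)"
  shows "antimono_on {0<..<1} (cond_bound A R)"
proof (rule monotone_onI)
  fix a b :: real
  assume ab: "a \<in> {0<..<1}" "b \<in> {0<..<1}" "a \<le> b"
  have "(1 - b) / b \<le> (1 - a) / a"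
    using ab ratio_strict_decreasing[of a b] by (cases "a = b") auto
  moreover have "0 \<le> lambda_max A / lambda_min (transpose R ** R)"
    using pos_semidef_lambda_max_nonneg[OF A] pos_def_lambda_min_pos[OF R] by simp
  ultimately show "cond_bound A R a \<ge> cond_bound A R b"
    using ab by (simp only: cond_bound_affine_in_ratio greaterThanLessThan_iff)
      (intro add_right_mono mult_right_mono)
qed

lemma strict_antimono_cond_bound:
  assumes A: "pos_semidef A" "A \<noteq> 0" and R: "pos_def (transpose R ** R)"
  shows "strict_antimono_on {0<..<1} (cond_bound A R)"
proof (rule monotone_onI)
  fix a b :: real
  assume ab: "a \<in> {0<..<1}" "b \<in> {0<..<1}" "a < b"
  have "(1 - b) / b < (1 - a) / a" using ab ratio_strict_decreasing[of a b] by simp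
  moreover have "0 < lambda_max A / lambda_min (transpose R ** R)"
    using pos_semidef_lambda_max_pos[OF A] pos_def_lambda_min_pos[OF R] by simp
  ultimately show "cond_bound A R a > cond_bound A R b"
    using ab by (simp only: cond_bound_affine_in_ratio greaterThanLessThan_iff)
      (intro add_strict_right_mono mult_strict_right_mono)
qed

lemma cond_bound_scaled_identity:
  assumes R: "pos_def (transpose R ** R)" and lbar: "transpose R ** R = lbar *\<^sub>R mat 1"
    and \<alpha>: "0 < \<alpha>"
  shows "cond_bound A R \<alpha> = (1 - \<alpha>) / \<alpha> * (lambda_max A / lbar) + 1"
proof -
  have sym: "symmetric_matrix (transpose R ** R)" using R by (simp add: pos_def_def)
  have "lambda_max (transpose R ** R) = lbar" "lambda_min (transpose R ** R) = lbar"
    using lambda_max_rayleigh(1)[OF sym] lambda_min_rayleigh(1)[OF sym]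
    by (simp_all add: lbar eigenvalue_scaled_identity)
  then show ?thesis
    using cond_bound_affine_in_ratio[OF \<alpha>, of A R] pos_def_lambda_min_pos[OF R] by simp
qed

lemma affine_in_ratio_bigo:
  fixes c :: real
  shows "(\<lambda>\<alpha>. (1 - \<alpha>) / \<alpha> * c + 1) \<in> O[at_right 0](\<lambda>\<alpha>. (1 - \<alpha>) / \<alpha>)"
proof (rule bigoI)
  have "eventually (\<lambda>\<alpha>::real. \<alpha> \<in> {0<..<1/2}) (at_right 0)"
    by (rule eventually_at_right_real) simp
  then show "eventually (\<lambda>\<alpha>. norm ((1 - \<alpha>) / \<alpha> * c + 1) \<le> (\<bar>c\<bar> + 1) * norm ((1 - \<alpha>) / \<alpha>)) (at_right 0)"
  proof eventually_elim
    case (elim \<alpha>)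
    define r where "r = (1 - \<alpha>) / \<alpha>"
    have r: "1 \<le> r" using elim by (simp add: r_def field_simps)
    have "\<bar>r * c + 1\<bar> \<le> \<bar>r * c\<bar> + 1" by linarith
    also have "\<dots> \<le> (\<bar>c\<bar> + 1) * \<bar>r\<bar>" using r by (simp add: abs_mult algebra_simps)
    finally show ?case by (simp only: real_norm_def r_def)
  qed
qed

theorem proposition5p1:
  fixes A :: "real^'n^'n" and R :: "real^'n^'m"
  assumes "pos_semidef A" and "pos_def (transpose R ** R)"
  shows "(\<forall>\<alpha>\<in>{0<..<1}. pos_def (blend A R \<alpha>) \<and> cond_number (blend A R \<alpha>) \<le> cond_bound A R \<alpha>) \<and>
    antimono_on {0<..<1} (cond_bound A R) \<and>
    (A \<noteq> 0 \<longrightarrow> strict_antimono_on {0<..<1} (cond_bound A R)) \<and>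
    (\<forall>lbar. transpose R ** R = lbar *\<^sub>R mat 1 \<longrightarrow>
       (\<forall>\<alpha>\<in>{0<..<1}.
          cond_bound A R \<alpha> = (1 - \<alpha>) / \<alpha> * (lambda_max A / lbar) + 1 \<and>
          cond_number (blend A R \<alpha>) \<le> (1 - \<alpha>) / \<alpha> * (lambda_max A / lbar) + 1) \<and>
       (\<lambda>\<alpha>. (1 - \<alpha>) / \<alpha> * (lambda_max A / lbar) + 1) \<in> O[at_right 0](\<lambda>\<alpha>. (1 - \<alpha>) / \<alpha>) \<and>
       (\<lambda>\<alpha>. cond_number (blend A R \<alpha>)) \<in> O[at_right 0](\<lambda>\<alpha>. (1 - \<alpha>) / \<alpha>))"
proof (intro conjI ballI impI allI)
  note A = assms(1) and R = assms(2)
  show "antimono_on {0<..<1} (cond_bound A R)" by (rule antimono_cond_bound[OF A R])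
  show "strict_antimono_on {0<..<1} (cond_bound A R)" if "A \<noteq> 0"
    by (rule strict_antimono_cond_bound[OF A that R])
  fix \<alpha> :: real assume \<alpha>: "\<alpha> \<in> {0<..<1}"
  show "pos_def (blend A R \<alpha>)" using pos_def_blend[OF A R] \<alpha> by simp
  show bound: "cond_number (blend A R \<alpha>) \<le> cond_bound A R \<alpha>"
    using cond_number_blend_le[OF A R] \<alpha> by simp
  fix lbar :: real assume lbar: "transpose R ** R = lbar *\<^sub>R mat 1"
  show closed_form: "cond_bound A R \<alpha> = (1 - \<alpha>) / \<alpha> * (lambda_max A / lbar) + 1"
    using cond_bound_scaled_identity[OF R lbar] \<alpha> by simp
  show "cond_number (blend A R \<alpha>) \<le> (1 - \<alpha>) / \<alpha> * (lambda_max A / lbar) + 1"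
    using bound closed_form by simp
next
  note A = assms(1) and R = assms(2)
  fix lbar :: real assume lbar: "transpose R ** R = lbar *\<^sub>R mat 1"
  let ?b = "\<lambda>\<alpha>. (1 - \<alpha>) / \<alpha> * (lambda_max A / lbar) + 1"
  show bigo: "?b \<in> O[at_right 0](\<lambda>\<alpha>. (1 - \<alpha>) / \<alpha>)" by (rule affine_in_ratio_bigo)
  have "eventually (\<lambda>\<alpha>::real. \<alpha> \<in> {0<..<1}) (at_right 0)"
    by (rule eventually_at_right_real) simp
  then have "eventually (\<lambda>\<alpha>. norm (cond_number (blend A R \<alpha>)) \<le> 1 * norm (?b \<alpha>)) (at_right 0)"
  proof eventually_elim
    case (elim \<alpha>)
    then have "0 < \<alpha>" "\<alpha> < 1" by auto
    then have "0 \<le> cond_number (blend A R \<alpha>)" "cond_number (blend A R \<alpha>) \<le> ?b \<alpha>"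
      using cond_number_nonneg[OF pos_def_blend[OF A R]] cond_number_blend_le[OF A R]
        cond_bound_scaled_identity[OF R lbar] by auto
    then show ?case by simp
  qed
  then have "(\<lambda>\<alpha>. cond_number (blend A R \<alpha>)) \<in> O[at_right 0](?b)" by (rule bigoI)
  then show "(\<lambda>\<alpha>. cond_number (blend A R \<alpha>)) \<in> O[at_right 0](\<lambda>\<alpha>. (1 - \<alpha>) / \<alpha>)"
    using bigo by (rule landau_o.big_trans)
qed

end
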